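(* If $T$ is a non-trivial tree, then $i(T)<\gamma_{{\rm ri}2}(T)$.
   Context: All graphs are finite and simple. A tree is non-trivial if it has at least two vertices. $i(G)$ denotes the independent domination number of a graph $G$, i.e. the minimum cardinality of a set that is both independent and dominating in $G$. A $2$-rainbow independent dominating function of a graph $G$ is a function $f\colon V(G)\to\{0,1,2\}$ such that, with $V_i=\{x\in V(G): f(x)=i\}$, (1) $V_1$ and $V_2$ are independent sets in $G$, and (2) every $x\in V_0$ has at least one neighbor in $V_1$ and at least one neighbor in $V_2$. Its weight is $|V_1|+|V_2|$. The $2$-rainbow independent domination number $\gamma_{{\rm ri}2}(G)$ is the minimum weight of a $2$-rainbow independent dominating function of $G$. *)

theory Defs
  imports "Graph_Theory.Graph_Theory"
begin

text \<open>
  Finite simple graphs are the symmetric loop-free finite digraphs of the locale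
  \<^locale>\<open>pair_graph\<close>: an edge \<open>{u, v}\<close> is the pair of arcs \<open>(u, v)\<close>, \<open>(v, u)\<close>.
  In this encoding the arcs \<open>(u, v)\<close>, \<open>(v, u)\<close> form a directed cycle of length two, so
  \<^const>\<open>tree\<close> fails for every graph with an edge. A directed cycle of length at
  least three in such a digraph is exactly a cycle (with a direction) of the undirected graph.
\<close>

definition undirected_tree :: "'a pair_pre_digraph \<Rightarrow> bool" where
  "undirected_tree G \<longleftrightarrow>
     pair_graph G \<and> connected G \<and>
     \<not> (\<exists>p. pre_digraph.cycle (with_proj G) p \<and> 3 \<le> length p)"

definition independent_set :: "'a pair_pre_digraph \<Rightarrow> 'a set \<Rightarrow> bool" where
  "independent_set G S \<longleftrightarrow>
     S \<subseteq> pverts G \<and> (\<forall>u\<in>S. \<forall>v\<in>S. (u, v) \<notin> parcs G)"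

definition dominating_set :: "'a pair_pre_digraph \<Rightarrow> 'a set \<Rightarrow> bool" where
  "dominating_set G S \<longleftrightarrow>
     S \<subseteq> pverts G \<and> (\<forall>u\<in>pverts G - S. \<exists>v\<in>S. (u, v) \<in> parcs G)"

definition independent_domination_number :: "'a pair_pre_digraph \<Rightarrow> nat" where
  "independent_domination_number G =
     (LEAST k. \<exists>S. independent_set G S \<and> dominating_set G S \<and> card S = k)"

definition label_class :: "'a pair_pre_digraph \<Rightarrow> ('a \<Rightarrow> nat) \<Rightarrow> nat \<Rightarrow> 'a set" where
  "label_class G f i = {x \<in> pverts G. f x = i}"

text \<open>The values of \<open>f\<close> outside the vertex set are irrelevant.\<close>

definition two_rainbow_indep_dom :: "'a pair_pre_digraph \<Rightarrow> ('a \<Rightarrow> nat) \<Rightarrow> bool" where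
  "two_rainbow_indep_dom G f \<longleftrightarrow>
     f \<in> pverts G \<rightarrow> {0, 1, 2} \<and>
     independent_set G (label_class G f 1) \<and>
     independent_set G (label_class G f 2) \<and>
     (\<forall>x\<in>label_class G f 0.
        (\<exists>y\<in>label_class G f 1. (x, y) \<in> parcs G) \<and>
        (\<exists>z\<in>label_class G f 2. (x, z) \<in> parcs G))"

definition rainbow_weight :: "'a pair_pre_digraph \<Rightarrow> ('a \<Rightarrow> nat) \<Rightarrow> nat" where
  "rainbow_weight G f = card (label_class G f 1) + card (label_class G f 2)"

definition two_rainbow_indep_dom_number :: "'a pair_pre_digraph \<Rightarrow> nat" where
  "two_rainbow_indep_dom_number G =
     (LEAST k. \<exists>f. two_rainbow_indep_dom G f \<and> rainbow_weight G f = k)"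

text \<open>Both minima range over nonempty sets, so they are attained.\<close>

lemma maximal_independent_in:
  assumes "pair_graph G" "A \<subseteq> pverts G"
  obtains S where "S \<subseteq> A" "independent_set G S" "\<forall>u\<in>A - S. \<exists>v\<in>S. (u, v) \<in> parcs G"
proof -
  interpret pair_graph G by fact
  let ?I = "{S. S \<subseteq> A \<and> independent_set G S}"
  have "finite A"
    using assms(2) pair_finite_verts by (rule finite_subset)
  then have "finite ?I" by simp
  moreover have "{} \<in> ?I" by (simp add: independent_set_def)
  ultimately have "\<exists>S\<in>?I. \<forall>S'\<in>?I. S \<subseteq> S' \<longrightarrow> S = S'"
    by (intro finite_has_maximal) blast+
  then obtain S where SI: "S \<in> ?I" and max: "\<forall>S'\<in>?I. S \<subseteq> S' \<longrightarrow> S = S'"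
    by (rule bexE)
  from SI have S: "S \<subseteq> A" "independent_set G S" by simp_all
  have "\<exists>v\<in>S. (u, v) \<in> parcs G" if u: "u \<in> A - S" for u
  proof (rule ccontr)
    assume "\<not> (\<exists>v\<in>S. (u, v) \<in> parcs G)"
    moreover have "(v, u) \<in> parcs G \<Longrightarrow> (u, v) \<in> parcs G" for v
      using arcs_ends_symmetric[OF pair_sym_arcs, of v u] by simp
    moreover have "(u, u) \<notin> parcs G"
      using pair_no_loops[of "(u, u)"] by auto
    ultimately have "\<forall>x\<in>insert u S. \<forall>y\<in>insert u S. (x, y) \<notin> parcs G"
      using S unfolding independent_set_def by blast
    then have "insert u S \<in> ?I"
      using S u assms(2) unfolding independent_set_def by blast
    then have "S = insert u S"
      using max by blast
    then show False using u by blast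
  qed
  then show thesis using S by (intro that) blast+
qed

lemma independent_domination_number_attained:
  assumes "pair_graph G"
  shows "\<exists>S. independent_set G S \<and> dominating_set G S \<and> card S = independent_domination_number G"
proof -
  obtain S where "S \<subseteq> pverts G" "independent_set G S"
      "\<forall>u\<in>pverts G - S. \<exists>v\<in>S. (u, v) \<in> parcs G"
    by (rule maximal_independent_in[OF assms order_refl])
  then have "\<exists>k S. independent_set G S \<and> dominating_set G S \<and> card S = k"
    by (auto simp: independent_set_def dominating_set_def)
  then show ?thesis
    unfolding independent_domination_number_def by (rule LeastI_ex)
qed

lemma two_rainbow_indep_dom_number_attained:
  fixes G :: "'a pair_pre_digraph"
  assumes "pair_graph G"
  shows "\<exists>f. two_rainbow_indep_dom G f \<and> rainbow_weight G f = two_rainbow_indep_dom_number G"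
proof -
  obtain S where S: "S \<subseteq> pverts G" "independent_set G S"
      "\<forall>u\<in>pverts G - S. \<exists>v\<in>S. (u, v) \<in> parcs G"
    by (rule maximal_independent_in[OF assms order_refl])
  obtain R where R: "R \<subseteq> pverts G - S" "independent_set G R"
      "\<forall>u\<in>(pverts G - S) - R. \<exists>v\<in>R. (u, v) \<in> parcs G"
    by (rule maximal_independent_in[OF assms Diff_subset])
  define f :: "'a \<Rightarrow> nat" where "f x = (if x \<in> S then 1 else if x \<in> R then 2 else 0)" for x
  have "label_class G f 1 = S" "label_class G f 2 = R" "label_class G f 0 = pverts G - S - R"
    using S(1) R(1) by (auto simp: label_class_def f_def)
  moreover have "f \<in> pverts G \<rightarrow> {0, 1, 2}"
    by (auto simp: f_def)
  ultimately have "two_rainbow_indep_dom G f"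
    using S(2,3) R(2,3) by (simp add: two_rainbow_indep_dom_def)
  then have "\<exists>k f. two_rainbow_indep_dom G f \<and> rainbow_weight G f = k" by blast
  then show ?thesis
    unfolding two_rainbow_indep_dom_number_def by (rule LeastI_ex)
qed

end

theory Submission
  imports Defs
begin

text \<open>
  Let \<open>V\<^sub>0, V\<^sub>1, V\<^sub>2\<close> be the label classes of a minimum 2-rainbow independent dominating function.
  If some edge joins \<open>V\<^sub>1\<close> and \<open>V\<^sub>2\<close>, then \<open>V\<^sub>1\<close> together with the vertices of \<open>V\<^sub>2\<close> having no
  neighbour in \<open>V\<^sub>1\<close> is independent and dominating, and it omits a vertex of \<open>V\<^sub>2\<close>. Otherwise
  \<open>W = V\<^sub>1 \<union> V\<^sub>2\<close> is independent, so connectedness yields a vertex \<open>v \<in> V\<^sub>0\<close>. Exchanging the neighbours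
  of \<open>v\<close> in \<open>W\<close>, of which there are at least two, for \<open>v\<close> keeps the set independent. It stays
  dominating because a vertex of \<open>V\<^sub>0\<close> whose neighbours in \<open>W\<close> (again at least two) were all removed
  would lie on a 4-cycle with \<open>v\<close>.
\<close>

lemma (in pair_graph) parcs_sym: "(u, v) \<in> parcs G \<Longrightarrow> (v, u) \<in> parcs G"
  using arcs_ends_symmetric[OF pair_sym_arcs, of u v] by simp

lemma (in pair_graph) parcs_irrefl: "(u, u) \<notin> parcs G"
  using pair_no_loops[of "(u, u)"] by auto

text \<open>The closed walk \<open>v\<close>, \<open>a\<close>, \<open>u\<close>, \<open>b\<close>,
  \<open>v\<close> has four arcs, so the length bound in \<open>undirected_tree\<close> rules it out
  as a cycle.\<close>

lemma undirected_tree_no_4_cycle: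
  assumes "undirected_tree G" "u \<noteq> v" "a \<noteq> b"
    and "(v, a) \<in> parcs G" "(v, b) \<in> parcs G" "(u, a) \<in> parcs G" "(u, b) \<in> parcs G"
  shows False
proof -
  interpret pair_graph G using assms(1) by (simp add: undirected_tree_def)
  let ?p = "[(v, a), (a, u), (u, b), (b, v)]"
  have arcs: "(a, u) \<in> parcs G" "(b, v) \<in> parcs G"
    using assms parcs_sym by blast+
  have ne: "v \<noteq> a" "v \<noteq> b" "u \<noteq> a" "u \<noteq> b"
    using assms parcs_irrefl by blast+
  have "v \<in> pverts G"
    using assms(4) in_arcsD1 by blast
  then have "cycle ?p"
    using assms arcs ne by (auto simp: cycle_def awalk_def)
  then show False
    using assms(1) by (fastforce simp: undirected_tree_def)
qed

text \<open>Connectedness is reachability in the symmetric closure, here the same as in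
  \<open>G\<close>; a path between two distinct vertices starts with an arc.\<close>

lemma connected_ex_arc:
  fixes G :: "'a pair_pre_digraph"
  assumes "pair_graph G" "connected G" "2 \<le> card (pverts G)"
  shows "\<exists>u v. (u, v) \<in> parcs G"
proof (rule ccontr)
  assume no: "\<not> (\<exists>u v. (u, v) \<in> parcs G)"
  interpret pair_graph G by fact
  obtain x y where xy: "x \<in> pverts G" "y \<in> pverts G" "x \<noteq> y"
    using assms(3) by (metis card_le_Suc0_iff_eq not_less_eq_eq numeral_2_eq_2 pair_finite_verts)
  have "x \<rightarrow>\<^sup>*\<^bsub>with_proj (mk_symmetric G)\<^esub> y"
    using assms(2) xy by (auto simp: connected_def elim: strongly_connectedE)
  then have "x \<rightarrow>\<^sup>*\<^bsub>G\<^esub> y"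
    using reachable_mk_symmetric_eq[OF pair_sym_arcs] by simp
  then show False
    by (cases rule: converse_reachable_cases) (use no xy in auto)
qed

lemma independent_domination_number_le:
  assumes "independent_set G S" "dominating_set G S"
  shows "independent_domination_number G \<le> card S"
  unfolding independent_domination_number_def using assms by (intro Least_le) blast

theorem theorem3p4:
  fixes T :: "'a pair_pre_digraph"
  assumes "undirected_tree T"
    and "2 \<le> card (pverts T)"
  shows "independent_domination_number T < two_rainbow_indep_dom_number T"
proof -
  have conn: "connected T" and graph: "pair_graph T"
    using assms(1) by (simp_all add: undirected_tree_def)
  interpret pair_graph T by (fact graph)
  obtain f where f: "two_rainbow_indep_dom T f"
    and weight: "rainbow_weight T f = two_rainbow_indep_dom_number T"
    using two_rainbow_indep_dom_number_attained[OF graph] by blast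
  define V0 V1 V2 where "V0 = label_class T f 0" "V1 = label_class T f 1" "V2 = label_class T f 2"
  define W where "W = V1 \<union> V2"
  note V_defs = V0_V1_V2_def
  have indep: "independent_set T V1" "independent_set T V2"
    and dom: "\<And>x. x \<in> V0 \<Longrightarrow> \<exists>y\<in>V1. (x, y) \<in> parcs T" "\<And>x. x \<in> V0 \<Longrightarrow> \<exists>z\<in>V2. (x, z) \<in> parcs T"
    and verts: "pverts T = V0 \<union> V1 \<union> V2"
    using f by (auto simp: two_rainbow_indep_dom_def V_defs label_class_def)
  have disj: "V1 \<inter> V2 = {}" "V0 \<inter> W = {}"
    by (auto simp: V_defs W_def label_class_def)
  have fin: "finite V1" "finite V2" "finite W"
    using pair_finite_verts by (simp_all add: verts W_def)
  have card_W: "card W = two_rainbow_indep_dom_number T"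
    unfolding weight[symmetric] rainbow_weight_def W_def V_defs[symmetric]
    using fin disj by (simp add: card_Un_disjoint)
  have "\<exists>S. independent_set T S \<and> dominating_set T S \<and> card S < card W"
  proof (cases "\<exists>x\<in>V1. \<exists>y\<in>V2. (y, x) \<in> parcs T")
    case True
    then obtain x y where xy: "x \<in> V1" "y \<in> V2" "(y, x) \<in> parcs T" by blast
    let ?S = "V1 \<union> {z \<in> V2. \<forall>x\<in>V1. (z, x) \<notin> parcs T}"
    have "independent_set T ?S"
      using indep parcs_sym unfolding independent_set_def by blast
    \<comment> \<open>Vertices of \<open>V0\<close> see \<open>V1\<close> by \<open>dom(1)\<close>,
      the omitted ones of \<open>V2\<close> by the choice of \<open>?S\<close>.\<close>
    moreover have "dominating_set T ?S"
      using dom(1) unfolding dominating_set_def verts by blast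
    moreover have "?S \<subset> W"
      using xy disj unfolding W_def by blast
    ultimately show ?thesis
      using fin(3) psubset_card_mono by blast
  next
    case False
    then have W_indep: "independent_set T W"
      using indep parcs_sym unfolding independent_set_def W_def by blast
    \<comment> \<open>Non-triviality enters here: on a single vertex \<open>V0\<close> is empty and
      both numbers are 1.\<close>
    have "V0 \<noteq> {}"
    proof
      assume "V0 = {}"
      then have "pverts T = W" by (simp add: verts W_def)
      moreover obtain u v where "(u, v) \<in> parcs T"
        using connected_ex_arc[OF graph conn assms(2)] by blast
      ultimately show False
        using W_indep in_arcsD1 in_arcsD2 unfolding independent_set_def by blast
    qed
    then obtain v where v: "v \<in> V0" by blast
    let ?N = "{a \<in> W. (v, a) \<in> parcs T}"
    let ?S = "insert v (W - ?N)"
    have two_nbrs: "\<exists>a\<in>W. \<exists>b\<in>W. a \<noteq> b \<and> (u, a) \<in> parcs T \<and> (u, b) \<in> parcs T" if u: "u \<in> V0" for u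
    proof -
      obtain a b where "a \<in> V1" "b \<in> V2" "(u, a) \<in> parcs T" "(u, b) \<in> parcs T"
        using dom[OF u] by blast
      moreover from this have "a \<noteq> b" using disj(1) by blast
      ultimately show ?thesis unfolding W_def by blast
    qed
    have "independent_set T ?S"
      using W_indep v verts parcs_sym parcs_irrefl unfolding independent_set_def by blast
    moreover have "\<exists>w\<in>?S. (u, w) \<in> parcs T" if u: "u \<in> pverts T - ?S" for u
    proof (cases "u \<in> W")
      case True
      \<comment> \<open>A vertex of \<open>W\<close> outside \<open>?S\<close> was removed as a
        neighbour of \<open>v\<close>, so \<open>v\<close> dominates it.\<close>
      then show ?thesis using u parcs_sym by blast
    next
      case False
      then have "u \<in> V0" "u \<noteq> v" using u verts W_def by blast+
      then obtain a b where "a \<in> W" "b \<in> W" "a \<noteq> b" "(u, a) \<in> parcs T" "(u, b) \<in> parcs T"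
        using two_nbrs by blast
      then show ?thesis
        using undirected_tree_no_4_cycle[OF assms(1) \<open>u \<noteq> v\<close> \<open>a \<noteq> b\<close>] by blast
    qed
    then have "dominating_set T ?S"
      using v verts unfolding dominating_set_def W_def by blast
    moreover have "card ?S < card W"
    proof -
      obtain a b where ab: "a \<in> ?N" "b \<in> ?N" "a \<noteq> b"
        using two_nbrs[OF v] by blast
      then have "card ?S \<le> card (insert v (W - {a, b}))"
        using fin(3) by (intro card_mono) auto
      also have "\<dots> \<le> Suc (card (W - {a, b}))"
        by (rule card_insert_le_m1) simp_all
      \<comment> \<open>\<open>card_mono\<close> supplies 2 \<le> \<open>card W\<close>, so the
        subtraction of 2 is not truncated.\<close>
      also have "\<dots> < card W"
        using ab fin(3) card_mono[OF fin(3), of "{a, b}"] by (simp add: card_Diff_subset)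
      finally show ?thesis .
    qed
    ultimately show ?thesis by blast
  qed
  then show ?thesis
    using independent_domination_number_le card_W by fastforce
qed

end
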